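(* Let $n\ge2$ and $p\in\mathrm{Hom}_+(n,n)$. Define $q_n=p$ and, for $1\le i\le n-1$, $q_i\in\mathrm{Hom}_+(i,i)$ by $q_i(x_1,\dots,x_i)=\frac{\partial^{n-i}}{\partial x_{i+1}\cdots\partial x_n}p(x_1,\dots,x_i,0,\dots,0)$. (1) If $\mathrm{Cap}(q_{i-1})\ge \mathrm{Cap}(q_i)\,G(i)$ for all $2\le i\le n$, then $$\frac{\partial^n}{\partial x_1\cdots\partial x_n}p(0,\dots,0)=\mathrm{Cap}(q_1)\ge \frac{n!}{n^n}\mathrm{Cap}(p),$$ and moreover $$\frac{\partial^n p}{\partial x_1\partial x_2\partial x_3\cdots\partial x_n}(0)+\sqrt{\frac{\partial^n p}{\partial x_1\partial x_1\partial x_3\cdots\partial x_n}(0)\cdot\frac{\partial^n p}{\partial x_2\partial x_2\partial x_3\cdots\partial x_n}(0)}\ \ge\ 2\,\frac{n!}{n^n}\,\mathrm{Cap}(p).$$ (2) If $\mathrm{Cap}(q_{i-1})\ge\mathrm{Cap}(q_i)\,G(\deg_{q_i}(i))$ for all $2\le i\le n$, then $$\frac{\partial^n}{\partial x_1\cdots\partial x_n}p(0,\dots,0)=\mathrm{Cap}(q_1)\ge \mathrm{Cap}(p)\prod_{2\le i\le n}G\big(\min(i,\deg_p(i))\big).$$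
   Context: $\mathrm{Hom}_+(m,n)$: homogeneous polynomials of degree $n$ in $m$ variables with real nonnegative coefficients. For $q\in\mathrm{Hom}_+(i,i)$, $\mathrm{Cap}(q)=\inf_{x_1,\dots,x_i>0}\frac{q(x_1,\dots,x_i)}{x_1\cdots x_i}$. $\deg_q(j)$ is the maximal exponent of $x_j$ over the monomials of $q$ with nonzero coefficient (taken to be $0$ if $q=0$). $G(1)=1$, $G(m)=\left(\frac{m-1}{m}\right)^{m-1}$ for integers $m\ge 2$, and we use the convention $G(0)=1$. *)

theory Defs
  imports "HOL-Analysis.Analysis" "HOL-Library.Poly_Mapping"
begin

text \<open>
  A real polynomial is a finitely supported coefficient function on monomials, and a monomial is a
  finitely supported exponent function on variables. The variables are \<open>x\<^sub>1, x\<^sub>2, \<dots>\<close>, so index 0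
  is not used.
\<close>

type_synonym monom = "nat \<Rightarrow>\<^sub>0 nat"
type_synonym rpoly = "monom \<Rightarrow>\<^sub>0 real"

definition meval :: "monom \<Rightarrow> (nat \<Rightarrow> real) \<Rightarrow> real" where
  "meval \<mu> x = (\<Prod>j\<in>Poly_Mapping.keys \<mu>. x j ^ Poly_Mapping.lookup \<mu> j)"

definition peval :: "rpoly \<Rightarrow> (nat \<Rightarrow> real) \<Rightarrow> real" where
  "peval p x = (\<Sum>\<mu>\<in>Poly_Mapping.keys p. Poly_Mapping.lookup p \<mu> * meval \<mu> x)"

definition mdegree :: "monom \<Rightarrow> nat" where
  "mdegree \<mu> = (\<Sum>j\<in>Poly_Mapping.keys \<mu>. Poly_Mapping.lookup \<mu> j)"

definition Hom_plus :: "nat \<Rightarrow> nat \<Rightarrow> rpoly set" where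
  "Hom_plus m n = {p. \<forall>\<mu>\<in>Poly_Mapping.keys p.
     Poly_Mapping.keys \<mu> \<subseteq> {1..m} \<and> mdegree \<mu> = n \<and> 0 \<le> Poly_Mapping.lookup p \<mu>}"

text \<open>
  Term by term: \<open>c x\<^sup>\<mu>\<close> becomes \<open>c \<mu>\<^sub>j x\<^sup>\<mu> / x\<^sub>j\<close>. If \<open>\<mu>\<^sub>j = 0\<close>, the new coefficient is 0 and the
  truncated subtraction in the exponent does not matter. Lemma \<open>peval_pdiff\<close> below shows that this
  is the analytic partial derivative.
\<close>

definition pdiff :: "nat \<Rightarrow> rpoly \<Rightarrow> rpoly" where
  "pdiff j p = (\<Sum>\<mu>\<in>Poly_Mapping.keys p.
     Poly_Mapping.single (\<mu> - Poly_Mapping.single j 1)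
       (Poly_Mapping.lookup p \<mu> * real (Poly_Mapping.lookup \<mu> j)))"

definition pdiffs :: "nat list \<Rightarrow> rpoly \<Rightarrow> rpoly" where
  "pdiffs js p = foldr pdiff js p"

definition set_zero :: "nat set \<Rightarrow> rpoly \<Rightarrow> rpoly" where
  "set_zero S p = (\<Sum>\<mu>\<in>{\<mu> \<in> Poly_Mapping.keys p. Poly_Mapping.keys \<mu> \<inter> S = {}}.
     Poly_Mapping.single \<mu> (Poly_Mapping.lookup p \<mu>))"

definition Cap :: "nat \<Rightarrow> rpoly \<Rightarrow> real" where
  "Cap i q = (INF x\<in>{x. \<forall>j\<in>{1..i}. 0 < x j}. peval q x / (\<Prod>j=1..i. x j))"

definition deg_in :: "rpoly \<Rightarrow> nat \<Rightarrow> nat" where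
  "deg_in q j =
     (if q = 0 then 0 else Max ((\<lambda>\<mu>. Poly_Mapping.lookup \<mu> j) ` Poly_Mapping.keys q))"

definition G :: "nat \<Rightarrow> real" where
  "G m = (if m \<le> 1 then 1 else ((real m - 1) / real m) ^ (m - 1))"

definition qpoly :: "nat \<Rightarrow> rpoly \<Rightarrow> nat \<Rightarrow> rpoly" where
  "qpoly n p i = (if i = n then p else set_zero {i+1..n} (pdiffs [i+1..<n+1] p))"

lemma peval_superset:
  assumes "finite A" "Poly_Mapping.keys p \<subseteq> A"
  shows "peval p x = (\<Sum>\<mu>\<in>A. Poly_Mapping.lookup p \<mu> * meval \<mu> x)"
  unfolding peval_def
  by (rule sum.mono_neutral_left[OF assms]) (auto simp: in_keys_iff)

lemma peval_zero [simp]: "peval 0 x = 0"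
  by (simp add: peval_def)

lemma peval_add: "peval (p + q) x = peval p x + peval q x"
proof -
  let ?A = "Poly_Mapping.keys p \<union> Poly_Mapping.keys q"
  have "Poly_Mapping.keys (p + q) \<subseteq> ?A" by (rule Poly_Mapping.keys_add)
  then show ?thesis
    by (simp add: peval_superset[of ?A] lookup_add distrib_right sum.distrib)
qed

lemma peval_single [simp]: "peval (Poly_Mapping.single \<mu> c) x = c * meval \<mu> x"
  by (simp add: peval_superset[of "{\<mu>}"])

lemma peval_sum: "peval (\<Sum>a\<in>A. f a) x = (\<Sum>a\<in>A. peval (f a) x)"
  by (induction A rule: infinite_finite_induct) (auto simp: peval_add)

lemma meval_superset:
  assumes "finite A" "Poly_Mapping.keys \<mu> \<subseteq> A"
  shows "meval \<mu> x = (\<Prod>j\<in>A. x j ^ Poly_Mapping.lookup \<mu> j)"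
  unfolding meval_def
  by (rule prod.mono_neutral_left[OF assms]) (auto simp: in_keys_iff)

lemma meval_split:
  "meval \<mu> x = x j ^ Poly_Mapping.lookup \<mu> j *
     (\<Prod>k\<in>Poly_Mapping.keys \<mu> - {j}. x k ^ Poly_Mapping.lookup \<mu> k)"
proof -
  have "meval \<mu> x = (\<Prod>k\<in>insert j (Poly_Mapping.keys \<mu>). x k ^ Poly_Mapping.lookup \<mu> k)"
    by (rule meval_superset) auto
  then show ?thesis by (simp add: prod.insert_remove)
qed

lemma meval_minus_single:
  "meval (\<mu> - Poly_Mapping.single j 1) x = x j ^ (Poly_Mapping.lookup \<mu> j - 1) *
     (\<Prod>k\<in>Poly_Mapping.keys \<mu> - {j}. x k ^ Poly_Mapping.lookup \<mu> k)"
proof -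
  have sub: "Poly_Mapping.keys (\<mu> - Poly_Mapping.single j 1) \<subseteq> insert j (Poly_Mapping.keys \<mu>)"
    by (auto simp: in_keys_iff lookup_minus lookup_single)
  have "meval (\<mu> - Poly_Mapping.single j 1) x =
      (\<Prod>k\<in>insert j (Poly_Mapping.keys \<mu>). x k ^ Poly_Mapping.lookup (\<mu> - Poly_Mapping.single j 1) k)"
    by (rule meval_superset[OF _ sub]) auto
  also have "\<dots> = x j ^ (Poly_Mapping.lookup \<mu> j - 1) *
     (\<Prod>k\<in>Poly_Mapping.keys \<mu> - {j}. x k ^ Poly_Mapping.lookup \<mu> k)"
    by (auto simp: prod.insert_remove lookup_minus lookup_single when_def intro!: prod.cong)
  finally show ?thesis .
qed

lemma peval_pdiff:
  "((\<lambda>t. peval p (x(j := t))) has_real_derivative peval (pdiff j p) x) (at (x j))"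
proof -
  have D: "((\<lambda>t. meval \<mu> (x(j := t))) has_real_derivative
      real (Poly_Mapping.lookup \<mu> j) * meval (\<mu> - Poly_Mapping.single j 1) x) (at (x j))" for \<mu>
  proof -
    let ?c = "\<Prod>k\<in>Poly_Mapping.keys \<mu> - {j}. x k ^ Poly_Mapping.lookup \<mu> k"
    have eq: "meval \<mu> (x(j := t)) = t ^ Poly_Mapping.lookup \<mu> j * ?c" for t
      by (simp add: meval_split[of _ _ j])
    show ?thesis
      unfolding eq meval_minus_single by (auto intro!: derivative_eq_intros)
  qed
  have "((\<lambda>t. \<Sum>\<mu>\<in>Poly_Mapping.keys p. Poly_Mapping.lookup p \<mu> * meval \<mu> (x(j := t)))
     has_real_derivative (\<Sum>\<mu>\<in>Poly_Mapping.keys p. Poly_Mapping.lookup p \<mu> *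
       (real (Poly_Mapping.lookup \<mu> j) * meval (\<mu> - Poly_Mapping.single j 1) x))) (at (x j))"
    by (intro DERIV_sum DERIV_cmult D)
  then show ?thesis
    by (simp add: peval_def[of p] pdiff_def peval_sum mult.assoc)
qed

lemma peval_set_zero: "peval (set_zero S p) x = peval p (\<lambda>j. if j \<in> S then 0 else x j)"
proof -
  have "meval \<mu> (\<lambda>j. if j \<in> S then 0 else x j) =
      (if Poly_Mapping.keys \<mu> \<inter> S = {} then meval \<mu> x else 0)" for \<mu>
    unfolding meval_def
    by (auto simp: disjoint_iff in_keys_iff intro!: prod.cong)
  note m = this
  have "peval (set_zero S p) x =
      (\<Sum>\<mu>\<in>{\<mu> \<in> Poly_Mapping.keys p. Poly_Mapping.keys \<mu> \<inter> S = {}}. Poly_Mapping.lookup p \<mu> * meval \<mu> x)"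
    by (simp add: set_zero_def peval_sum)
  also have "\<dots> = (\<Sum>\<mu>\<in>Poly_Mapping.keys p.
      Poly_Mapping.lookup p \<mu> * (if Poly_Mapping.keys \<mu> \<inter> S = {} then meval \<mu> x else 0))"
    by (auto simp: sum.inter_filter intro!: sum.cong)
  finally show ?thesis unfolding peval_def[of p] m .
qed

lemma mdegree_superset:
  assumes "finite A" "Poly_Mapping.keys \<mu> \<subseteq> A"
  shows "mdegree \<mu> = (\<Sum>j\<in>A. Poly_Mapping.lookup \<mu> j)"
  unfolding mdegree_def
  by (rule sum.mono_neutral_left[OF assms]) (auto simp: in_keys_iff)

lemma Hom_plus_zero: "0 \<in> Hom_plus m n"
  by (simp add: Hom_plus_def)

lemma Hom_plus_add:
  assumes "p \<in> Hom_plus m n" "q \<in> Hom_plus m n"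
  shows "p + q \<in> Hom_plus m n"
proof -
  have nn: "0 \<le> Poly_Mapping.lookup r \<mu>" if "r \<in> Hom_plus m n" for r \<mu>
    using that by (cases "\<mu> \<in> Poly_Mapping.keys r") (auto simp: Hom_plus_def in_keys_iff)
  show ?thesis
    using assms Poly_Mapping.keys_add[of p q] nn[OF assms(1)] nn[OF assms(2)]
    unfolding Hom_plus_def by (auto simp: lookup_add dest!: subsetD)
qed

lemma Hom_plus_sum:
  assumes "\<And>a. a \<in> A \<Longrightarrow> f a \<in> Hom_plus m n"
  shows "(\<Sum>a\<in>A. f a) \<in> Hom_plus m n"
  using assms
  by (induction A rule: infinite_finite_induct) (auto simp: Hom_plus_zero Hom_plus_add)

lemma pdiff_in_Hom_plus:
  assumes "p \<in> Hom_plus m (Suc n)"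
  shows "pdiff j p \<in> Hom_plus m n"
  unfolding pdiff_def
proof (rule Hom_plus_sum)
  fix \<mu> assume \<mu>: "\<mu> \<in> Poly_Mapping.keys p"
  let ?\<nu> = "\<mu> - Poly_Mapping.single j 1"
  show "Poly_Mapping.single ?\<nu> (Poly_Mapping.lookup p \<mu> * real (Poly_Mapping.lookup \<mu> j))
      \<in> Hom_plus m n"
  proof (cases "Poly_Mapping.lookup \<mu> j = 0")
    case True
    then show ?thesis by (simp add: Hom_plus_zero)
  next
    case False
    have h: "Poly_Mapping.keys \<mu> \<subseteq> {1..m}" "mdegree \<mu> = Suc n" "0 \<le> Poly_Mapping.lookup p \<mu>"
      using assms \<mu> by (auto simp: Hom_plus_def)
    have jk: "j \<in> Poly_Mapping.keys \<mu>" using False by (simp add: in_keys_iff)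
    have sub: "Poly_Mapping.keys ?\<nu> \<subseteq> Poly_Mapping.keys \<mu>"
      by (auto simp: in_keys_iff lookup_minus)
    have "mdegree ?\<nu> = (\<Sum>k\<in>Poly_Mapping.keys \<mu>. Poly_Mapping.lookup ?\<nu> k)"
      by (rule mdegree_superset[OF _ sub]) simp
    also have "\<dots> = Poly_Mapping.lookup \<mu> j - 1 +
        (\<Sum>k\<in>Poly_Mapping.keys \<mu> - {j}. Poly_Mapping.lookup \<mu> k)"
      using jk by (auto simp: sum.remove[of _ j] lookup_minus lookup_single when_def
          intro!: sum.cong)
    finally have "mdegree ?\<nu> = n"
      using h(2) False jk by (simp add: mdegree_def sum.remove[of _ j])
    then show ?thesis
      using h sub by (auto simp: Hom_plus_def)
  qed
qed

lemma pdiffs_in_Hom_plus: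
  assumes "p \<in> Hom_plus m (n + length js)"
  shows "pdiffs js p \<in> Hom_plus m n"
  using assms
  by (induction js arbitrary: n) (force simp: pdiffs_def intro: pdiff_in_Hom_plus)+

lemma qpoly_in_Hom_plus:
  assumes "p \<in> Hom_plus n n" "i \<le> n"
  shows "qpoly n p i \<in> Hom_plus i i"
proof (cases "i = n")
  case True
  then show ?thesis using assms by (simp add: qpoly_def)
next
  case False
  have "pdiffs [i+1..<n+1] p \<in> Hom_plus n i"
    using assms False by (intro pdiffs_in_Hom_plus) (simp del: upt_Suc)
  then have "set_zero {i+1..n} (pdiffs [i+1..<n+1] p) \<in> Hom_plus i i"
    unfolding set_zero_def
    by (intro Hom_plus_sum) (fastforce simp: Hom_plus_def)
  then show ?thesis using False by (simp add: qpoly_def)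
qed

end

theory Submission
  imports Defs
begin

text \<open>
  Chaining the hypotheses bounds \<open>Cap(q\<^sub>k)\<close> below by \<open>Cap(p)\<close> times the product of the factors
  with index above \<open>k\<close>, and \<open>\<Prod> G(i)\<close> telescopes to \<open>n!/n\<^sup>n\<close>. In (2), \<open>G\<close> is decreasing and
  differentiation does not raise degrees. Euler's identity shows that \<open>q\<^sub>1 = c x\<^sub>1\<close> and
  \<open>q\<^sub>2 = a x\<^sub>1\<^sup>2/2 + c x\<^sub>1 x\<^sub>2 + b x\<^sub>2\<^sup>2/2\<close>, where \<open>c, a, b\<close> are the mixed derivatives of \<open>p\<close>, and
  minimising \<open>q\<^sub>2(t,1)/t\<close> over \<open>t > 0\<close> gives \<open>Cap(q\<^sub>2) \<le> c + \<surd>(a b)\<close>.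
\<close>

section \<open>Coefficients of derivatives, Euler's identity and forms of degree at most two\<close>

lemma lookup_pdiff:
  "Poly_Mapping.lookup (pdiff j p) \<nu> =
     real (Poly_Mapping.lookup \<nu> j + 1) * Poly_Mapping.lookup p (\<nu> + Poly_Mapping.single j 1)"
proof -
  let ?e = "Poly_Mapping.single j (1::nat)"
  \<comment> \<open>Truncated subtraction is invertible only where the exponent of
    \<open>x_j\<close> is positive. A monomial with exponent 0 may also be sent to \<nu>, but its
    factor \<open>lookup \<mu> j\<close> is then 0, so \<nu> \<open>+ ?e\<close> is the only
    contributing monomial.\<close>
  have iff: "\<mu> - ?e = \<nu> \<longleftrightarrow> \<mu> = \<nu> + ?e" if "Poly_Mapping.lookup \<mu> j \<noteq> 0" for \<mu>
  proof
    assume "\<mu> - ?e = \<nu>"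
    then show "\<mu> = \<nu> + ?e"
      using that by (auto intro!: poly_mapping_eqI simp: lookup_add lookup_minus lookup_single when_def)
  qed simp
  have "Poly_Mapping.lookup (pdiff j p) \<nu> = (\<Sum>\<mu>\<in>Poly_Mapping.keys p.
      (Poly_Mapping.lookup p \<mu> * real (Poly_Mapping.lookup \<mu> j) when \<mu> - ?e = \<nu>))"
    by (simp add: pdiff_def lookup_sum lookup_single)
  also have "\<dots> = (\<Sum>\<mu>\<in>Poly_Mapping.keys p. if \<mu> = \<nu> + ?e
      then Poly_Mapping.lookup p \<mu> * real (Poly_Mapping.lookup \<mu> j) else 0)"
  proof (rule sum.cong[OF refl])
    fix \<mu>
    show "(Poly_Mapping.lookup p \<mu> * real (Poly_Mapping.lookup \<mu> j) when \<mu> - ?e = \<nu>) =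
        (if \<mu> = \<nu> + ?e then Poly_Mapping.lookup p \<mu> * real (Poly_Mapping.lookup \<mu> j) else 0)"
    proof (cases "Poly_Mapping.lookup \<mu> j = 0")
      case False
      then show ?thesis using iff[OF False] by (simp add: when_def)
    qed (auto simp: when_def lookup_add)
  qed
  also have "\<dots> = real (Poly_Mapping.lookup \<nu> j + 1) * Poly_Mapping.lookup p (\<nu> + ?e)"
    by (auto simp: lookup_add in_keys_iff)
  finally show ?thesis .
qed

lemma pdiff_commute: "pdiff j (pdiff k p) = pdiff k (pdiff j p)"
  by (rule poly_mapping_eqI)
    (auto simp: lookup_pdiff lookup_add lookup_single when_def add_ac)

text \<open>Applying \<open>x_j\<close> times the \<open>j\<close>-th derivative multiplies each
  monomial by its exponent at \<open>j\<close>; these exponents sum to \<open>n\<close>, because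
  every variable that occurs lies in \<open>{1..m}\<close>.\<close>

lemma euler_identity:
  assumes "p \<in> Hom_plus m n"
  shows "real n * peval p x = (\<Sum>j=1..m. x j * peval (pdiff j p) x)"
proof -
  have E: "x j * (real (Poly_Mapping.lookup \<mu> j) * meval (\<mu> - Poly_Mapping.single j 1) x) =
      real (Poly_Mapping.lookup \<mu> j) * meval \<mu> x" for \<mu> j
  proof (cases "Poly_Mapping.lookup \<mu> j")
    case (Suc k)
    then show ?thesis
      by (simp only: meval_minus_single meval_split[of \<mu> x j]) simp
  qed simp
  have "(\<Sum>j=1..m. x j * peval (pdiff j p) x) =
      (\<Sum>j=1..m. \<Sum>\<mu>\<in>Poly_Mapping.keys p.
        Poly_Mapping.lookup p \<mu> * (real (Poly_Mapping.lookup \<mu> j) * meval \<mu> x))"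
    unfolding E[symmetric] by (simp add: pdiff_def peval_sum sum_distrib_left mult_ac)
  also have "\<dots> = (\<Sum>\<mu>\<in>Poly_Mapping.keys p. \<Sum>j=1..m.
        Poly_Mapping.lookup p \<mu> * (real (Poly_Mapping.lookup \<mu> j) * meval \<mu> x))"
    by (rule sum.swap)
  also have "\<dots> = (\<Sum>\<mu>\<in>Poly_Mapping.keys p. real n * (Poly_Mapping.lookup p \<mu> * meval \<mu> x))"
  proof (rule sum.cong[OF refl])
    fix \<mu> assume "\<mu> \<in> Poly_Mapping.keys p"
    then have k: "Poly_Mapping.keys \<mu> \<subseteq> {1..m}" and d: "mdegree \<mu> = n"
      using assms by (auto simp: Hom_plus_def)
    have "real n = (\<Sum>j=1..m. real (Poly_Mapping.lookup \<mu> j))"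
      using mdegree_superset[OF _ k] d by simp
    then show "(\<Sum>j=1..m. Poly_Mapping.lookup p \<mu> * (real (Poly_Mapping.lookup \<mu> j) * meval \<mu> x)) =
        real n * (Poly_Mapping.lookup p \<mu> * meval \<mu> x)"
      by (simp add: sum_distrib_left sum_distrib_right mult_ac)
  qed
  finally show ?thesis by (simp add: peval_def sum_distrib_left)
qed

lemma peval_Hom_plus_0:
  assumes "p \<in> Hom_plus m 0"
  shows "peval p x = peval p y"
proof -
  have "meval \<mu> z = 1" if "\<mu> \<in> Poly_Mapping.keys p" for \<mu> z
  proof -
    have "mdegree \<mu> = 0" using assms that by (auto simp: Hom_plus_def)
    then have "Poly_Mapping.keys \<mu> = {}" by (auto simp add: mdegree_def in_keys_iff simp del: keys_eq_empty)
    then show ?thesis by (simp add: meval_def)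
  qed
  then show ?thesis by (simp add: peval_def)
qed

text \<open>The derivatives in Euler's identity have degree 0 here, so they are constants and may be
  taken at the origin.\<close>

lemma peval_Hom_plus_1:
  assumes "p \<in> Hom_plus m 1"
  shows "peval p x = (\<Sum>j=1..m. x j * peval (pdiff j p) (\<lambda>_. 0))"
proof -
  have "peval (pdiff j p) x = peval (pdiff j p) (\<lambda>_. 0)" for j
    using assms pdiff_in_Hom_plus[of p m 0 j] peval_Hom_plus_0 by simp
  then show ?thesis
    using euler_identity[OF assms, of x] by simp
qed

text \<open>Euler's identity in degree 2 supplies the factor 2, and each first derivative is then
  expanded as a linear form.\<close>

lemma peval_Hom_plus_2:
  assumes "p \<in> Hom_plus m 2"
  shows "2 * peval p x =
    (\<Sum>j=1..m. \<Sum>k=1..m. x j * x k * peval (pdiff k (pdiff j p)) (\<lambda>_. 0))"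
proof -
  have h: "pdiff j p \<in> Hom_plus m 1" for j
    using assms pdiff_in_Hom_plus[of p m 1 j] by (simp add: numeral_2_eq_2)
  show ?thesis
    using euler_identity[OF assms, of x]
    by (simp add: peval_Hom_plus_1[OF h] sum_distrib_left mult_ac)
qed

section \<open>Nonnegativity and elementary bounds for the capacity\<close>

lemma peval_nonneg:
  assumes "p \<in> Hom_plus m n" "\<And>j. j \<in> {1..m} \<Longrightarrow> 0 \<le> x j"
  shows "0 \<le> peval p x"
  unfolding peval_def meval_def
proof (intro sum_nonneg mult_nonneg_nonneg prod_nonneg zero_le_power)
  fix \<mu> assume "\<mu> \<in> Poly_Mapping.keys p"
  then have \<mu>: "Poly_Mapping.keys \<mu> \<subseteq> {1..m}" "0 \<le> Poly_Mapping.lookup p \<mu>"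
    using assms(1) by (auto simp: Hom_plus_def)
  then show "0 \<le> Poly_Mapping.lookup p \<mu>" by blast
  show "0 \<le> x j" if "j \<in> Poly_Mapping.keys \<mu>" for j
    using that \<mu>(1) assms(2) by blast
qed

lemma Cap_nonneg:
  assumes "q \<in> Hom_plus i n"
  shows "0 \<le> Cap i q"
  unfolding Cap_def
proof (rule cINF_greatest)
  show "{x::nat \<Rightarrow> real. \<forall>j\<in>{1..i}. 0 < x j} \<noteq> {}"
    by (auto intro!: exI[of _ "\<lambda>_. 1"])
next
  fix x :: "nat \<Rightarrow> real" assume "x \<in> {x. \<forall>j\<in>{1..i}. 0 < x j}"
  then show "0 \<le> peval q x / (\<Prod>j=1..i. x j)"
    by (intro divide_nonneg_nonneg peval_nonneg[OF assms] prod_nonneg) (auto simp: less_imp_le)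
qed

text \<open>A real infimum lies below its members only if the set is bounded below; nonnegative
  coefficients give the bound 0.\<close>

lemma Cap_le:
  assumes "q \<in> Hom_plus i n" "\<And>j. j \<in> {1..i} \<Longrightarrow> 0 < x j"
  shows "Cap i q \<le> peval q x / (\<Prod>j=1..i. x j)"
  unfolding Cap_def
proof (rule cINF_lower)
  show "bdd_below ((\<lambda>x. peval q x / (\<Prod>j=1..i. x j)) ` {x. \<forall>j\<in>{1..i}. 0 < x j})"
    by (intro bdd_belowI[of _ 0])
      (auto intro!: divide_nonneg_nonneg peval_nonneg[OF assms(1)] prod_nonneg simp: less_imp_le)
qed (use assms(2) in auto)

section \<open>The polynomials \<open>q_i\<close> and the capacities of \<open>q_1\<close> and
  \<open>q_2\<close>\<close>

lemma qpoly_eq: "qpoly n p i = set_zero {i+1..n} (pdiffs [i+1..<n+1] p)"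
proof (cases "i = n")
  case True
  \<comment> \<open>For \<open>i = n\<close> no variable is differentiated or set to zero, so
    \<open>set_zero {}\<close> has to return \<open>p\<close>, rebuilt here from its terms. The
    general formula then covers every \<open>i\<close>.\<close>
  have "(\<Sum>\<mu>\<in>Poly_Mapping.keys p. Poly_Mapping.single \<mu> (Poly_Mapping.lookup p \<mu>)) = p"
    by (rule poly_mapping_eqI) (auto simp: lookup_sum lookup_single when_def in_keys_iff)
  with True show ?thesis
    by (simp add: qpoly_def pdiffs_def set_zero_def)
qed (simp add: qpoly_def)

lemma pdiffs_upt_in_Hom_plus:
  assumes "p \<in> Hom_plus n n" "i \<le> n"
  shows "pdiffs [i+1..<n+1] p \<in> Hom_plus n i"
  using assms by (intro pdiffs_in_Hom_plus) (simp del: upt_Suc)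

lemma pdiffs_Cons: "pdiffs (j # js) p = pdiff j (pdiffs js p)"
  by (simp add: pdiffs_def)

text \<open>The quotient \<open>q_1(x) / x_1\<close> is constant, so its infimum is that
  constant.\<close>

lemma Cap_qpoly_1:
  assumes "1 \<le> n" "p \<in> Hom_plus n n"
  shows "Cap 1 (qpoly n p 1) = peval (pdiffs [1..<n+1] p) (\<lambda>_. 0)"
proof -
  let ?P = "pdiffs [2..<n+1] p"
  have P: "?P \<in> Hom_plus n 1"
    using pdiffs_upt_in_Hom_plus[OF assms(2,1)] by (simp add: numeral_2_eq_2)
  have l: "[1..<n+1] = 1 # [2..<n+1]"
    using assms(1) by (simp add: upt_conv_Cons numeral_2_eq_2 del: upt_Suc)
  have "peval (qpoly n p 1) x = x 1 * peval (pdiffs [1..<n+1] p) (\<lambda>_. 0)" for x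
  proof -
    have "peval (qpoly n p 1) x =
        (\<Sum>j=1..n. (if j \<in> {2..n} then 0 else x j) * peval (pdiff j ?P) (\<lambda>_. 0))"
      unfolding qpoly_eq peval_set_zero
      using peval_Hom_plus_1[OF P, of "\<lambda>j. if j \<in> {2..n} then 0 else x j"]
      by (simp add: numeral_2_eq_2 del: upt_Suc)
    \<comment> \<open>All variables but the first have been set to zero.\<close>
    also have "\<dots> = (\<Sum>j\<in>{1}. x j * peval (pdiff j ?P) (\<lambda>_. 0))"
      using assms(1) by (intro sum.mono_neutral_cong_right) auto
    finally show ?thesis unfolding l pdiffs_Cons by simp
  qed
  then have "Cap 1 (qpoly n p 1) =
      (INF x\<in>{x::nat \<Rightarrow> real. 0 < x 1}. peval (pdiffs [1..<n+1] p) (\<lambda>_. 0))"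
    unfolding Cap_def by (intro INF_cong) auto
  also have "{x::nat \<Rightarrow> real. 0 < x 1} \<noteq> {}"
    by (auto intro!: exI[of _ "\<lambda>_. 1"])
  then have "(INF x\<in>{x::nat \<Rightarrow> real. 0 < x 1}. peval (pdiffs [1..<n+1] p) (\<lambda>_. 0)) =
      peval (pdiffs [1..<n+1] p) (\<lambda>_. 0)"
    by (rule cINF_const)
  finally show ?thesis .
qed

lemma le_sqrt_mult:
  fixes a b c :: real
  assumes a: "0 \<le> a" and b: "0 \<le> b" and le: "\<And>t. 0 < t \<Longrightarrow> 2 * c \<le> a * t + b / t"
  shows "c \<le> sqrt (a * b)"
proof -
  have eps: "c \<le> sqrt ((a + e) * (b + e))" if e: "0 < e" for e
  proof -
    define u v where "u = sqrt (a + e)" and "v = sqrt (b + e)"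
    have uv: "0 < u" "0 < v" "a + e = u * u" "b + e = v * v"
      using a b e by (auto simp: u_def v_def)
    \<comment> \<open>\<open>v / u\<close> is the minimiser for the raised coefficients; there both
      terms equal \<open>u v\<close>.\<close>
    have "2 * c \<le> a * (v / u) + b / (v / u)"
      using uv by (intro le) simp
    also have "\<dots> \<le> (a + e) * (v / u) + (b + e) / (v / u)"
      using uv(1,2) e by (intro add_mono mult_right_mono divide_right_mono) auto
    also have "\<dots> = 2 * (u * v)" using uv(1,2) by (simp add: uv(3,4))
    finally show ?thesis by (simp add: u_def v_def real_sqrt_mult)
  qed
  have "((\<lambda>e. sqrt ((a + e) * (b + e))) \<longlongrightarrow> sqrt ((a + 0) * (b + 0))) (at_right 0)"
    by (intro tendsto_intros)
  then have "c \<le> sqrt ((a + 0) * (b + 0))"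
    by (rule tendsto_lowerbound) (auto intro!: eventually_at_rightI[of 0 1] eps)
  then show ?thesis by simp
qed

lemma Cap_qpoly_2:
  assumes "2 \<le> n" "p \<in> Hom_plus n n"
  shows "Cap 2 (qpoly n p 2) \<le> peval (pdiffs [1..<n+1] p) (\<lambda>_. 0)
    + sqrt (peval (pdiffs ([1, 1] @ [3..<n+1]) p) (\<lambda>_. 0)
          * peval (pdiffs ([2, 2] @ [3..<n+1]) p) (\<lambda>_. 0))"
proof -
  define R where "R = pdiffs [3..<n+1] p"
  define d where "d j k = peval (pdiff k (pdiff j R)) (\<lambda>_. 0)" for j k
  have R: "R \<in> Hom_plus n 2"
    using pdiffs_upt_in_Hom_plus[OF assms(2,1)] by (simp add: R_def numeral_2_eq_2 numeral_3_eq_3)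
  have q2: "qpoly n p 2 = set_zero {3..n} R"
    by (simp add: qpoly_eq R_def numeral_2_eq_2 numeral_3_eq_3 del: upt_Suc)
  have Q: "qpoly n p 2 \<in> Hom_plus 2 2"
    using qpoly_in_Hom_plus[OF assms(2,1)] .
  have "[1..<n+1] = 1 # 2 # [3..<n+1]"
    using assms(1) by (simp add: upt_conv_Cons numeral_2_eq_2 numeral_3_eq_3 del: upt_Suc)
  \<comment> \<open>\<open>foldr\<close> applies the last list entry first, so differentiation by
    \<open>x_2\<close> precedes that by \<open>x_1\<close>; hence \<open>d 2 1\<close>.\<close>
  then have d12: "peval (pdiffs [1..<n+1] p) (\<lambda>_. 0) = d 2 1"
    by (simp only: pdiffs_Cons d_def R_def)
  have d11: "peval (pdiffs ([1, 1] @ [3..<n+1]) p) (\<lambda>_. 0) = d 1 1"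
    and d22: "peval (pdiffs ([2, 2] @ [3..<n+1]) p) (\<lambda>_. 0) = d 2 2"
    by (simp_all only: append.simps pdiffs_Cons d_def R_def)
  have R': "pdiff k (pdiff j R) \<in> Hom_plus n 0" for j k
    using R by (auto intro!: pdiff_in_Hom_plus simp: numeral_2_eq_2)
  have nn: "0 \<le> d j k" for j k
    unfolding d_def using peval_nonneg[OF R'] by simp
  have sym: "d 1 2 = d 2 1" unfolding d_def by (subst pdiff_commute) simp
  have val: "2 * peval (qpoly n p 2) x = x 1 * x 1 * d 1 1 + 2 * (x 1 * x 2 * d 2 1) + x 2 * x 2 * d 2 2" for x
  proof -
    \<comment> \<open>Zeroing the variables from 3 on leaves only the indices 1 and 2 in the
      quadratic form of \<open>R\<close>.\<close>
    let ?y = "\<lambda>j. if j \<in> {3..n} then 0 else x j"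
    have "2 * peval (qpoly n p 2) x = (\<Sum>j=1..n. \<Sum>k=1..n. ?y j * ?y k * d j k)"
      unfolding q2 peval_set_zero d_def by (rule peval_Hom_plus_2[OF R])
    also have "\<dots> = (\<Sum>j\<in>{1,2}. \<Sum>k=1..n. ?y j * ?y k * d j k)"
      using assms(1) by (intro sum.mono_neutral_right) auto
    also have "\<dots> = (\<Sum>j\<in>{1,2}. \<Sum>k\<in>{1,2}. ?y j * ?y k * d j k)"
      using assms(1) by (intro sum.cong[OF refl] sum.mono_neutral_right) auto
    finally show ?thesis using sym by (simp add: algebra_simps)
  qed
  have "Cap 2 (qpoly n p 2) - d 2 1 \<le> sqrt (d 1 1 * d 2 2)"
  proof (rule le_sqrt_mult[OF nn nn])
    fix t :: real assume t: "0 < t"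
    \<comment> \<open>At the point \<open>(t, 1)\<close> the denominator is \<open>t\<close>, and
      the cross term contributes the constant \<open>d 2 1\<close>, which moves to the other
      side.\<close>
    let ?x = "(\<lambda>_. 1)(1 := t) :: nat \<Rightarrow> real"
    have pr: "(\<Prod>j=1..2. ?x j) = t" by (simp add: numeral_2_eq_2)
    have "Cap 2 (qpoly n p 2) \<le> peval (qpoly n p 2) ?x / (\<Prod>j=1..2. ?x j)"
      using t by (intro Cap_le[OF Q]) auto
    then have "2 * Cap 2 (qpoly n p 2) \<le> (2 * peval (qpoly n p 2) ?x) / t"
      unfolding pr by simp
    also have "\<dots> = d 1 1 * t + d 2 2 / t + 2 * d 2 1"
      unfolding val using t by (simp add: field_simps)
    finally show "2 * (Cap 2 (qpoly n p 2) - d 2 1) \<le> d 1 1 * t + d 2 2 / t" by simp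
  qed
  then show ?thesis unfolding d12 d11 d22 by simp
qed

section \<open>The function \<open>G\<close>: monotonicity, product, and chaining of
  inequalities\<close>

lemma G_nonneg: "0 \<le> G m"
  by (simp add: G_def)

text \<open>The case \<open>k = 0\<close> fits because \<open>0 ^ 0 = 1\<close>.\<close>

lemma G_Suc: "G (Suc k) = (real k / real (Suc k)) ^ k"
  by (cases k) (simp_all add: G_def)

text \<open>For \<open>m = k + 1\<close> with \<open>k > 0\<close>, put \<open>r = k\<close>.
  Bernoulli's inequality for \<open>(1 - 1/(r+1)^2) ^ (k+1)\<close> bounds it below by
  \<open>r / (r+1)\<close>. Factoring the base as \<open>(r/(r+1)) * ((r+2)/(r+1))\<close>,
  cancelling one \<open>r/(r+1)\<close> and multiplying by \<open>((r+1)/(r+2)) ^ (k+1)\<close>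
  gives the claim.\<close>

lemma G_Suc_le: "G (Suc m) \<le> G m"
proof (cases m)
  case 0
  then show ?thesis by (simp add: G_def)
next
  case (Suc k)
  show ?thesis
  proof (cases k)
    case 0
    then show ?thesis using Suc by (simp add: G_def)
  next
    case (Suc l)
    define r where "r = real k"
    have r: "r > 0" using Suc by (simp add: r_def)
    have "r / (r + 1) = 1 - 1 / (r + 1)"
      using r by (simp add: field_simps)
    also have "\<dots> = 1 + real (k + 1) * (- 1 / ((r + 1) * (r + 1)))"
      using r by (simp add: r_def add.commute)
    also have "\<dots> \<le> (1 + - 1 / ((r + 1) * (r + 1))) ^ (k + 1)"
    proof (rule Bernoulli_inequality)
      have "1 \<le> (r + 1) * (r + 1)" using r by (simp add: algebra_simps)
      then show "- 1 \<le> - 1 / ((r + 1) * (r + 1))" by (simp add: divide_le_eq)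
    qed
    also have "1 + - 1 / ((r + 1) * (r + 1)) = (r / (r + 1)) * ((r + 2) / (r + 1))"
      using r by (simp add: divide_simps) (simp add: algebra_simps)
    finally have "r / (r + 1) \<le> (r / (r + 1)) ^ (k + 1) * ((r + 2) / (r + 1)) ^ (k + 1)"
      by (simp only: power_mult_distrib)
    then have "r / (r + 1) * 1 \<le> (r / (r + 1)) * ((r / (r + 1)) ^ k * ((r + 2) / (r + 1)) ^ (k + 1))"
      by (simp add: mult_ac)
    then have "1 \<le> (r / (r + 1)) ^ k * ((r + 2) / (r + 1)) ^ (k + 1)"
      using r by (subst (asm) mult_le_cancel_left_pos) auto
    then have "((r + 1) / (r + 2)) ^ (k + 1) * 1 \<le>
        ((r + 1) / (r + 2)) ^ (k + 1) * ((r / (r + 1)) ^ k * ((r + 2) / (r + 1)) ^ (k + 1))"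
      using r by (intro mult_left_mono) auto
    also have "\<dots> = (r / (r + 1)) ^ k * (((r + 1) / (r + 2)) * ((r + 2) / (r + 1))) ^ (k + 1)"
      by (simp only: power_mult_distrib mult_ac)
    also have "((r + 1) / (r + 2)) * ((r + 2) / (r + 1)) = 1" using r by simp
    finally show ?thesis
      unfolding \<open>m = Suc k\<close> G_Suc by (simp add: r_def add_ac)
  qed
qed

lemma G_antimono: "m \<le> k \<Longrightarrow> G k \<le> G m"
  by (rule lift_Suc_antimono_le[of G]) (rule G_Suc_le)

text \<open>\<open>G (n+1) = n^n / (n+1)^n\<close> cancels the denominator of the previous product,
  and a factor \<open>n+1\<close> above and below restores the shape.\<close>

lemma prod_G: "1 \<le> n \<Longrightarrow> (\<Prod>i=2..n. G i) = fact n / real n ^ n"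
proof (induction n rule: dec_induct)
  case (step n)
  have "(\<Prod>i=2..Suc n. G i) = G (Suc n) * (fact n / real n ^ n)"
    using step by (simp add: prod.nat_ivl_Suc')
  also have "\<dots> = fact n / real (Suc n) ^ n"
    using step(1) by (simp add: G_Suc power_divide)
  also have "\<dots> = fact (Suc n) / real (Suc n) ^ Suc n"
    by (simp del: of_nat_Suc)
  finally show ?case .
qed simp

text \<open>Descending induction on \<open>k\<close>. A general end point is kept because the chain
  is stopped at 1 for the bounds on \<open>Cap(q_1)\<close> and at 2 for the bound with the square
  root.\<close>

lemma chain_mult_le:
  fixes c g :: "nat \<Rightarrow> real"
  assumes "\<And>i. i \<in> {k+1..n} \<Longrightarrow> c i * g i \<le> c (i - 1)" "\<And>i. 0 \<le> g i" "k \<le> n"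
  shows "c n * (\<Prod>i=k+1..n. g i) \<le> c k"
  using assms(3,1)
proof (induction k rule: inc_induct)
  case (step k)
  have "c n * (\<Prod>i=k+1..n. g i) = c n * (\<Prod>i=Suc k+1..n. g i) * g (Suc k)"
    using step(2) by (simp add: prod.atLeast_Suc_atMost)
  also have "\<dots> \<le> c (Suc k) * g (Suc k)"
    using step by (intro mult_right_mono assms(2)) auto
  also have "\<dots> \<le> c k" using step(2) step.prems[of "Suc k"] by simp
  finally show ?case .
qed simp

section \<open>Degrees under differentiation and substitution of zero\<close>

lemma deg_in_le:
  assumes "\<And>\<mu>. \<mu> \<in> Poly_Mapping.keys q \<Longrightarrow> Poly_Mapping.lookup \<mu> j \<le> d"
  shows "deg_in q j \<le> d"
  using assms by (auto simp: deg_in_def)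

lemma lookup_le_deg_in:
  assumes "\<mu> \<in> Poly_Mapping.keys q"
  shows "Poly_Mapping.lookup \<mu> j \<le> deg_in q j"
  using assms by (auto simp: deg_in_def)

text \<open>Each monomial of the derivative comes from one of \<open>p\<close> with the exponent at
  \<open>k\<close> larger by one.\<close>

lemma deg_in_pdiff_le: "deg_in (pdiff k p) j \<le> deg_in p j"
proof (rule deg_in_le)
  fix \<mu> assume "\<mu> \<in> Poly_Mapping.keys (pdiff k p)"
  then have "\<mu> + Poly_Mapping.single k 1 \<in> Poly_Mapping.keys p"
    by (auto simp: in_keys_iff lookup_pdiff)
  from lookup_le_deg_in[OF this, of j] show "Poly_Mapping.lookup \<mu> j \<le> deg_in p j"
    by (simp add: lookup_add)
qed

lemma deg_in_pdiffs_le: "deg_in (pdiffs ks p) j \<le> deg_in p j"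
proof (induction ks)
  case (Cons k ks)
  then show ?case
    unfolding pdiffs_Cons using deg_in_pdiff_le order_trans by blast
qed (simp add: pdiffs_def)

lemma deg_in_set_zero_le: "deg_in (set_zero S p) j \<le> deg_in p j"
proof (rule deg_in_le)
  fix \<mu> assume "\<mu> \<in> Poly_Mapping.keys (set_zero S p)"
  then have "\<mu> \<in> Poly_Mapping.keys p"
    by (auto simp: set_zero_def in_keys_iff lookup_sum lookup_single when_def split: if_splits)
  then show "Poly_Mapping.lookup \<mu> j \<le> deg_in p j" by (rule lookup_le_deg_in)
qed

lemma deg_in_Hom_plus_le:
  assumes "q \<in> Hom_plus m n"
  shows "deg_in q j \<le> n"
proof (rule deg_in_le)
  fix \<mu> assume "\<mu> \<in> Poly_Mapping.keys q"
  then have "mdegree \<mu> = n" using assms by (auto simp: Hom_plus_def)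
  moreover have "Poly_Mapping.lookup \<mu> j \<le> mdegree \<mu>"
    unfolding mdegree_def
    by (cases "j \<in> Poly_Mapping.keys \<mu>") (auto simp: in_keys_iff intro: member_le_sum)
  ultimately show "Poly_Mapping.lookup \<mu> j \<le> n" by simp
qed

text \<open>The bound \<open>i\<close> comes from homogeneity of \<open>q_i\<close>, the other from
  the fact that neither operation producing \<open>q_i\<close> raises a degree.\<close>

lemma deg_in_qpoly_le:
  assumes "p \<in> Hom_plus n n" "i \<le> n"
  shows "deg_in (qpoly n p i) i \<le> min i (deg_in p i)"
proof -
  have "deg_in (qpoly n p i) i \<le> deg_in p i"
    unfolding qpoly_eq using deg_in_set_zero_le deg_in_pdiffs_le order_trans by blast
  then show ?thesis
    using deg_in_Hom_plus_le[OF qpoly_in_Hom_plus[OF assms]] by simp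
qed

section \<open>Combining the estimates\<close>

theorem theorem2p8:
  fixes n :: nat and p :: rpoly
  assumes "n \<ge> 2" and "p \<in> Hom_plus n n"
  shows
    "((\<forall>i\<in>{2..n}. Cap (i - 1) (qpoly n p (i - 1)) \<ge> Cap i (qpoly n p i) * G i) \<longrightarrow>
        peval (pdiffs [1..<n+1] p) (\<lambda>_. 0) = Cap 1 (qpoly n p 1) \<and>
        Cap 1 (qpoly n p 1) \<ge> fact n / real n ^ n * Cap n p \<and>
        peval (pdiffs [1..<n+1] p) (\<lambda>_. 0)
          + sqrt (peval (pdiffs ([1, 1] @ [3..<n+1]) p) (\<lambda>_. 0)
                * peval (pdiffs ([2, 2] @ [3..<n+1]) p) (\<lambda>_. 0))
          \<ge> 2 * (fact n / real n ^ n) * Cap n p)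
     \<and>
     ((\<forall>i\<in>{2..n}. Cap (i - 1) (qpoly n p (i - 1)) \<ge> Cap i (qpoly n p i) * G (deg_in (qpoly n p i) i)) \<longrightarrow>
        peval (pdiffs [1..<n+1] p) (\<lambda>_. 0) = Cap 1 (qpoly n p 1) \<and>
        Cap 1 (qpoly n p 1) \<ge> Cap n p * (\<Prod>i=2..n. G (min i (deg_in p i))))"
proof (intro conjI impI)
  note n = assms(1) and p = assms(2)
  have n1: "1 \<le> n" using n by simp
  have qn: "qpoly n p n = p" by (simp add: qpoly_def)
  show eq: "peval (pdiffs [1..<n+1] p) (\<lambda>_. 0) = Cap 1 (qpoly n p 1)"
    using Cap_qpoly_1[OF n1 p] by simp
  then show "peval (pdiffs [1..<n+1] p) (\<lambda>_. 0) = Cap 1 (qpoly n p 1)" .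
  {
    assume H: "\<forall>i\<in>{2..n}. Cap (i - 1) (qpoly n p (i - 1)) \<ge> Cap i (qpoly n p i) * G i"
    have chain: "Cap n p * (\<Prod>i=k+1..n. G i) \<le> Cap k (qpoly n p k)" if "1 \<le> k" "k \<le> n" for k
      using chain_mult_le[of k n "\<lambda>i. Cap i (qpoly n p i)" G] H that by (simp add: G_nonneg qn)
    show "Cap 1 (qpoly n p 1) \<ge> fact n / real n ^ n * Cap n p"
      using chain[of 1] prod_G[OF n1] n by (simp add: mult.commute numeral_2_eq_2)
    \<comment> \<open>Stopping at \<open>q_2\<close> omits the factor \<open>G 2 = 1 / 2\<close>,
      which is the source of the 2 in the bound.\<close>
    have "(\<Prod>i=2..n. G i) = G 2 * (\<Prod>i=3..n. G i)"
      using n by (simp add: prod.atLeast_Suc_atMost numeral_3_eq_3 numeral_2_eq_2)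
    moreover have "G 2 = 1 / 2" by (simp add: G_def)
    ultimately have "(\<Prod>i=3..n. G i) = 2 * (fact n / real n ^ n)"
      using prod_G[OF n1] by (simp add: mult.commute)
    then have "2 * (fact n / real n ^ n) * Cap n p \<le> Cap 2 (qpoly n p 2)"
      using chain[of 2] n by (simp add: mult.commute)
    also note Cap_qpoly_2[OF n p]
    finally show "2 * (fact n / real n ^ n) * Cap n p \<le> peval (pdiffs [1..<n+1] p) (\<lambda>_. 0)
        + sqrt (peval (pdiffs ([1, 1] @ [3..<n+1]) p) (\<lambda>_. 0)
              * peval (pdiffs ([2, 2] @ [3..<n+1]) p) (\<lambda>_. 0))" .
  next
    assume H: "\<forall>i\<in>{2..n}. Cap (i - 1) (qpoly n p (i - 1))
      \<ge> Cap i (qpoly n p i) * G (deg_in (qpoly n p i) i)"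
    have "Cap i (qpoly n p i) * G (min i (deg_in p i)) \<le> Cap (i - 1) (qpoly n p (i - 1))"
      if i: "i \<in> {2..n}" for i
    proof -
      \<comment> \<open>Enlarging the argument of \<open>G\<close> lowers its value, and multiplying
        by the capacity keeps the inequality since the capacity is nonnegative.\<close>
      have "Cap i (qpoly n p i) * G (min i (deg_in p i)) \<le>
          Cap i (qpoly n p i) * G (deg_in (qpoly n p i) i)"
        using i p
        by (intro mult_left_mono G_antimono deg_in_qpoly_le Cap_nonneg[OF qpoly_in_Hom_plus]) auto
      also have "\<dots> \<le> Cap (i - 1) (qpoly n p (i - 1))" using H i by blast
      finally show ?thesis .
    qed
    then show "Cap 1 (qpoly n p 1) \<ge> Cap n p * (\<Prod>i=2..n. G (min i (deg_in p i)))"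
      using chain_mult_le[of 1 n "\<lambda>i. Cap i (qpoly n p i)" "\<lambda>i. G (min i (deg_in p i))"] n1
      by (simp add: G_nonneg qn numeral_2_eq_2)
  }
qed

end
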